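(* Let $r\ge 3$ and let $t$ be an integer with $1\le t\le r-2$. Then $\mathrm{cov}(r,r+t)\le t+1$.
   Context: A complete $r$-uniform $r$-partite hypergraph $K$ has a vertex set $V=V(K)$ partitioned into nonempty classes $V_1\cup\dots\cup V_r$, and its edges are exactly the sets containing one vertex from each class. A $k$-coloring of a hypergraph is an assignment of a color from $[k]=\{1,\dots,k\}$ to each edge (not all $k$ colors need be used). A coloring is spanning if every vertex is incident to edges of every color used in the coloring. For an edge-colored hypergraph $H$, let $H_i$ be the subhypergraph on vertex set $V(H)$ consisting of the edges of color $i$. A hypergraph is connected if it has only one vertex or any two distinct vertices can be connected by a sequence of edges each intersecting the next; every hypergraph is uniquely partitioned into connected components. A monochromatic component of $H$ is (the vertex set of) a connected component of $H_i$ for some color $i$. Let $c(H)$ be the minimum integer $m$ such that $V(H)$ can be covered by $m$ monochromatic components of $H$. $\mathrm{cov}(r,k)$ is the maximum of $c(K)$ when $K$ ranges over all spanning $k$-colorings of complete $r$-uniform $r$-partite hypergraphs. *)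

theory Defs
  imports Main "HOL-Library.Extended_Nat"
begin

text \<open>A hypergraph is given by a vertex set \<open>V\<close> and a set \<open>E\<close> of edges. It is not required
  to be finite.\<close>

definition joined :: "'v set set \<Rightarrow> 'v \<Rightarrow> 'v \<Rightarrow> bool" where
  "joined E u v \<longleftrightarrow> u = v \<or>
     (\<exists>es. es \<noteq> [] \<and> set es \<subseteq> E \<and> u \<in> hd es \<and> v \<in> last es \<and>
           successively (\<lambda>e f. e \<inter> f \<noteq> {}) es)"

definition components :: "'v set \<Rightarrow> 'v set set \<Rightarrow> 'v set set" where
  "components V E = {{v \<in> V. joined E u v} | u. u \<in> V}"

definition coloring :: "nat \<Rightarrow> 'v set set \<Rightarrow> ('v set \<Rightarrow> nat) \<Rightarrow> bool" where
  "coloring k E col \<longleftrightarrow> (\<forall>e\<in>E. col e \<in> {1..k})"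

definition color_class :: "'v set set \<Rightarrow> ('v set \<Rightarrow> nat) \<Rightarrow> nat \<Rightarrow> 'v set set" where
  "color_class E col i = {e \<in> E. col e = i}"

text \<open>The colors used are those in \<open>col ` E\<close>.\<close>

definition spanning :: "'v set \<Rightarrow> 'v set set \<Rightarrow> ('v set \<Rightarrow> nat) \<Rightarrow> bool" where
  "spanning V E col \<longleftrightarrow> (\<forall>v\<in>V. \<forall>i\<in>col ` E. \<exists>e\<in>color_class E col i. v \<in> e)"

text \<open>A color not used by the coloring contributes exactly the singletons.\<close>

definition mono_components ::
  "nat \<Rightarrow> 'v set \<Rightarrow> 'v set set \<Rightarrow> ('v set \<Rightarrow> nat) \<Rightarrow> 'v set set" where
  "mono_components k V E col = (\<Union>i\<in>{1..k}. components V (color_class E col i))"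

text \<open>The value is \<open>\<infinity>\<close> if no finite family of monochromatic components covers \<open>V\<close>.\<close>

definition cover_number ::
  "nat \<Rightarrow> 'v set \<Rightarrow> 'v set set \<Rightarrow> ('v set \<Rightarrow> nat) \<Rightarrow> enat" where
  "cover_number k V E col =
     Inf {enat (card C) | C. finite C \<and> C \<subseteq> mono_components k V E col \<and> V \<subseteq> \<Union>C}"

text \<open>\<open>P 1, \<dots>, P r\<close> are the partite classes; values of \<open>P\<close> at other indices are irrelevant.\<close>

definition partite_classes :: "nat \<Rightarrow> (nat \<Rightarrow> 'v set) \<Rightarrow> bool" where
  "partite_classes r P \<longleftrightarrow>
     (\<forall>j\<in>{1..r}. P j \<noteq> {}) \<and> (\<forall>i\<in>{1..r}. \<forall>j\<in>{1..r}. i \<noteq> j \<longrightarrow> P i \<inter> P j = {})"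

definition partite_verts :: "nat \<Rightarrow> (nat \<Rightarrow> 'v set) \<Rightarrow> 'v set" where
  "partite_verts r P = (\<Union>j\<in>{1..r}. P j)"

definition complete_partite_edges :: "nat \<Rightarrow> (nat \<Rightarrow> 'v set) \<Rightarrow> 'v set set" where
  "complete_partite_edges r P =
     {e. e \<subseteq> partite_verts r P \<and> (\<forall>j\<in>{1..r}. card (e \<inter> P j) = 1)}"

text \<open>The supremum over all spanning \<open>k\<close>-colorings of complete \<open>r\<close>-uniform \<open>r\<close>-partite hypergraphs
  whose vertices are taken from the type \<open>'v\<close>. A nonempty set of extended naturals with a finite
  upper bound contains its supremum, which is then a maximum.\<close>

definition cov :: "'v itself \<Rightarrow> nat \<Rightarrow> nat \<Rightarrow> enat" where
  "cov (_ :: 'v itself) r k =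
     Sup {cover_number k (partite_verts r P) (complete_partite_edges r P) col
       | (P :: nat \<Rightarrow> 'v set) (col :: 'v set \<Rightarrow> nat).
         partite_classes r P \<and>
         coloring k (complete_partite_edges r P) col \<and>
         spanning (partite_verts r P) (complete_partite_edges r P) col}"

end

theory Submission
  imports Defs
begin

text \<open>Each used color partitions the vertices into components, and since the coloring is spanning,
  every component meets every class. If fewer than \<open>t + 2\<close> components never cover, then no single
  component does, so a partial transversal can be extended greedily, each new vertex destroying
  one more color on which all vertices so far agree. As a full transversal is an edge, vertices
  of distinct classes differ in at most \<open>t + 1\<close> colors, with strong restrictions on third
  vertices in the case of equality. From \<open>t \<le> r - 2\<close> one gets vertices \<open>u\<close>, \<open>w\<close> of one class and
  \<open>v\<close> of another such that \<open>v\<close> differs from \<open>u\<close> and from \<open>w\<close> in disjoint sets of \<open>t + 1\<close> colors.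
  Then in any color where \<open>u\<close> and \<open>v\<close> differ, every vertex of a third class agrees with one of
  them, so two components of that color cover everything.\<close>

text \<open>\<open>f i v\<close> stands for the component of \<open>v\<close> in color \<open>i\<close>.\<close>

locale uncoverable_coloring =
  fixes r t :: nat and P :: "nat \<Rightarrow> 'v set" and I :: "'i set" and f :: "'i \<Rightarrow> 'v \<Rightarrow> 'b"
  assumes t: "1 \<le> t" "t + 2 \<le> r"
    and card_I: "finite I" "card I = r + t"
    and nonempty: "\<And>j. j \<in> {1..r} \<Longrightarrow> P j \<noteq> {}"
    and transversal_mono: "\<And>p. (\<And>j. j \<in> {1..r} \<Longrightarrow> p j \<in> P j) \<Longrightarrow>
      \<exists>i\<in>I. \<forall>j\<in>{1..r}. \<forall>j'\<in>{1..r}. f i (p j) = f i (p j')"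
    and meets: "\<And>i v j. i \<in> I \<Longrightarrow> v \<in> partite_verts r P \<Longrightarrow> j \<in> {1..r} \<Longrightarrow>
      \<exists>w\<in>P j. f i w = f i v"
    and no_cover: "\<And>K. finite K \<Longrightarrow> K \<subseteq> I \<times> partite_verts r P \<Longrightarrow> card K \<le> t + 1 \<Longrightarrow>
      \<exists>w\<in>partite_verts r P. \<forall>(i, v)\<in>K. f i w \<noteq> f i v"
begin

section \<open>Bounds on the number of colors separating two vertices\<close>

definition dif :: "'v \<Rightarrow> 'v \<Rightarrow> 'i set" where
  "dif u v = {i \<in> I. f i u \<noteq> f i v}"

lemma finite_dif [simp]: "finite (dif u v)"
  using card_I(1) by (simp add: dif_def)

lemma dif_commute: "dif u v = dif v u"
  by (auto simp: dif_def)

lemma partite_vertsI: "j \<in> {1..r} \<Longrightarrow> v \<in> P j \<Longrightarrow> v \<in> partite_verts r P"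
  by (auto simp: partite_verts_def)

text \<open>The component of \<open>v\<close> is not a cover; the component of a missed vertex meets
  \<open>P j\<close>, so the missed vertex can be moved into that class.\<close>

lemma differing_vertex:
  assumes "i \<in> I" "v \<in> partite_verts r P" "j \<in> {1..r}"
  obtains w where "w \<in> P j" "f i w \<noteq> f i v"
proof -
  obtain w where "w \<in> partite_verts r P" "f i w \<noteq> f i v"
    using no_cover[of "{(i, v)}"] assms by auto
  then show ?thesis
    using meets[OF assms(1) _ assms(3)] that by metis
qed

text \<open>If the colors of agreement were no more numerous than the classes outside
  \<open>J\<close>, each could be given an outside class of its own and be broken there by
  \<open>differing_vertex\<close>. The resulting full transversal would contradict
  \<open>transversal_mono\<close>.\<close>

lemma card_agreement:
  assumes J: "J \<subseteq> {1..r}" "J \<noteq> {}" and p: "\<And>j. j \<in> J \<Longrightarrow> p j \<in> P j"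
  shows "r < card {i \<in> I. \<forall>j\<in>J. \<forall>j'\<in>J. f i (p j) = f i (p j')} + card J"
proof (rule ccontr)
  define A where "A = {i \<in> I. \<forall>j\<in>J. \<forall>j'\<in>J. f i (p j) = f i (p j')}"
  assume "\<not> ?thesis"
  then have "card A \<le> card ({1..r} - J)"
    using J by (simp add: A_def card_Diff_subset finite_subset)
  moreover have "finite A"
    using card_I(1) by (simp add: A_def)
  ultimately obtain g where g: "g ` A \<subseteq> {1..r} - J" "inj_on g A"
    using card_le_inj[of A "{1..r} - J"] by auto
  obtain j0 where j0: "j0 \<in> J"
    using J by auto
  have pj0: "p j0 \<in> partite_verts r P"
    using j0 J p partite_vertsI by blast
  have "\<exists>w. w \<in> P j \<and> (j \<in> J \<longrightarrow> w = p j) \<and>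
      (\<forall>i\<in>A. j = g i \<longrightarrow> f i w \<noteq> f i (p j0))" if j: "j \<in> {1..r}" for j
  proof (cases "j \<in> J")
    case True
    then show ?thesis
      using p g by blast
  next
    case notJ: False
    show ?thesis
    proof (cases "j \<in> g ` A")
      case True
      then obtain i where i: "i \<in> A" "j = g i"
        by auto
      obtain w where "w \<in> P j" "f i w \<noteq> f i (p j0)"
        using differing_vertex[OF _ pj0 j] i by (auto simp: A_def)
      then show ?thesis
        using i notJ g(2) by (auto dest: inj_onD)
    next
      case False
      then show ?thesis
        using notJ nonempty[OF j] by auto
    qed
  qed
  then obtain q where q: "\<And>j. j \<in> {1..r} \<Longrightarrow> q j \<in> P j \<and> (j \<in> J \<longrightarrow> q j = p j) \<and>
      (\<forall>i\<in>A. j = g i \<longrightarrow> f i (q j) \<noteq> f i (p j0))"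
    by metis
  then obtain i where i: "i \<in> I" "\<And>j j'. j \<in> {1..r} \<Longrightarrow> j' \<in> {1..r} \<Longrightarrow> f i (q j) = f i (q j')"
    using transversal_mono[of q] by blast
  \<comment> \<open>A color constant on \<open>q\<close> is constant on \<open>J\<close>, yet
    \<open>q (g i)\<close> was chosen to break it.\<close>
  have "i \<in> A"
    using i q J unfolding A_def by (smt (verit) mem_Collect_eq subsetD)
  moreover have "g i \<in> {1..r}"
    using g \<open>i \<in> A\<close> by auto
  ultimately show False
    using q[of "g i"] q[of j0] i(2)[of "g i" j0] j0 J by (metis subsetD)
qed

lemma card_dif_le:
  assumes "a \<in> {1..r}" "b \<in> {1..r}" "a \<noteq> b" "u \<in> P a" "v \<in> P b"
  shows "card (dif u v) \<le> t + 1"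
proof -
  let ?p = "\<lambda>j. if j = a then u else v"
  have "{i \<in> I. \<forall>j\<in>{a, b}. \<forall>j'\<in>{a, b}. f i (?p j) = f i (?p j')} = I - dif u v"
    using assms by (auto simp: dif_def)
  moreover have "card (I - dif u v) + card (dif u v) = r + t"
    using card_I by (metis (no_types, lifting) add.commute card_Int_Diff dif_def inf.absorb2
        mem_Collect_eq subsetI)
  moreover have "?p j \<in> P j" if "j \<in> {a, b}" for j
    using assms that by auto
  ultimately show ?thesis
    using card_agreement[of "{a, b}" ?p] assms by simp
qed

section \<open>Pairs differing in exactly \<open>t + 1\<close> colors\<close>

lemma card_dif_third:
  assumes "a \<in> {1..r}" "b \<in> {1..r}" "c \<in> {1..r}" "a \<noteq> b" "c \<noteq> a" "c \<noteq> b"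
    and "u \<in> P a" "v \<in> P b" "x \<in> P c" and tight: "card (dif u v) = t + 1"
  shows "card (dif u x - dif u v) \<le> 1"
proof -
  let ?p = "\<lambda>j. if j = a then u else if j = b then v else x"
  let ?D = "dif u v \<union> dif u x"
  have "{i \<in> I. \<forall>j\<in>{a, b, c}. \<forall>j'\<in>{a, b, c}. f i (?p j) = f i (?p j')} = I - ?D"
    using assms by (auto simp: dif_def)
  moreover have "card (I - ?D) + card ?D = r + t"
  proof -
    have "?D \<subseteq> I"
      by (auto simp: dif_def)
    then show ?thesis
      using card_I by (metis add.commute card_Int_Diff inf.absorb2)
  qed
  moreover have "card ?D = card (dif u v) + card (dif u x - dif u v)"
    by (metis Un_Diff_cancel card_Un_disjoint Diff_disjoint finite_dif finite_Diff)
  moreover have "?p j \<in> P j" if "j \<in> {a, b, c}" for j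
    using assms that by auto
  \<comment> \<open>Agreement of three vertices in at least \<open>r - 2\<close> colors gives
    \<open>card ?D \<le> t + 2\<close>, and \<open>dif u v\<close> already accounts for
    \<open>t + 1\<close>.\<close>
  ultimately show ?thesis
    using card_agreement[of "{a, b, c}" ?p] assms by simp
qed

text \<open>The components of \<open>u\<close> in the \<open>t + 1\<close> colors of
  \<open>S\<close> miss some \<open>y\<close>. As \<open>u\<close> and \<open>v\<close> agree on
  \<open>S\<close>, \<open>y\<close> differs from both there. Its class is distinct from that of
  \<open>u\<close> or of \<open>v\<close>, and \<open>card_dif_le\<close> then leaves no room for a
  further color.\<close>

lemma tight_vertex:
  assumes ab: "a \<in> {1..r}" "b \<in> {1..r}" "a \<noteq> b" and uv: "u \<in> P a" "v \<in> P b"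
    and S: "S \<subseteq> I - dif u v" "card S = t + 1"
  obtains c y where "c \<in> {1..r}" "y \<in> P c" "c \<noteq> a \<and> dif u y = S \<or> c \<noteq> b \<and> dif v y = S"
proof -
  have [simp]: "finite S"
    using S card_I(1) finite_subset by blast
  have "u \<in> partite_verts r P"
    using ab uv partite_vertsI by blast
  then obtain y where y: "y \<in> partite_verts r P" "\<And>i. i \<in> S \<Longrightarrow> f i y \<noteq> f i u"
    using no_cover[of "(\<lambda>i. (i, u)) ` S"] S card_image_le[of S "\<lambda>i. (i, u)"] by fastforce
  then obtain c where c: "c \<in> {1..r}" "y \<in> P c"
    by (auto simp: partite_verts_def)
  have sub: "S \<subseteq> dif u y" "S \<subseteq> dif v y"
    using y(2) S by (fastforce simp: dif_def)+
  show ?thesis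
  proof (cases "c = a")
    case True
    then have "card (dif v y) \<le> card S"
      using card_dif_le[of b c v y] ab uv c S by auto
    then show ?thesis
      using that c sub True ab card_seteq by (metis finite_dif)
  next
    case False
    then have "card (dif u y) \<le> card S"
      using card_dif_le[of a c u y] ab uv c S by auto
    then show ?thesis
      using that c sub False card_seteq by (metis finite_dif)
  qed
qed

lemma third_class_agrees:
  assumes abc: "a \<in> {1..r}" "b \<in> {1..r}" "c \<in> {1..r}" "a \<noteq> b" "c \<noteq> a" "c \<noteq> b"
    and mem: "u \<in> P a" "w \<in> P a" "v \<in> P b" "x \<in> P c"
    and tight: "card (dif v u) = t + 1" "card (dif v w) = t + 1"
    and disj: "dif v u \<inter> dif v w = {}"
    and s: "s \<in> dif v u" "f s x \<noteq> f s v"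
  shows "f s x = f s u"
proof (rule ccontr)
  assume neq: "f s x \<noteq> f s u"
  have le1: "card (dif v x - dif v w) \<le> 1"
    using card_dif_third[of b a c v w x] abc mem tight by auto
  \<comment> \<open>Hence, by disjointness, \<open>x\<close> agrees with \<open>v\<close> on all of
    \<open>dif v u\<close> except \<open>s\<close>.\<close>
  have only_s: "i = s" if "i \<in> dif v x - dif v w" for i
  proof -
    have "s \<in> dif v x - dif v w"
      using s disj by (auto simp: dif_def)
    then show ?thesis
      using le1 that by (metis (no_types, lifting) One_nat_def card_le_Suc0_iff_eq finite_Diff
          finite_dif)
  qed
  \<comment> \<open>Otherwise \<open>x\<close> would differ from \<open>w\<close> on all of
    \<open>dif v w\<close> and also in \<open>s\<close>, where \<open>w\<close> agrees with
    \<open>v\<close>: \<open>t + 2\<close> colors, too many.\<close>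
  have "\<exists>i\<in>dif v w. f i x \<noteq> f i v"
  proof (rule ccontr)
    assume "\<not> ?thesis"
    then have "insert s (dif v w) \<subseteq> dif w x"
      using s disj by (auto simp: dif_def)
    then have "card (insert s (dif v w)) \<le> card (dif w x)"
      by (simp add: card_mono)
    moreover have "s \<notin> dif v w"
      using s disj by auto
    ultimately show False
      using card_dif_le[of a c w x] abc mem tight by auto
  qed
  then obtain i where i: "i \<in> dif v w" "f i x \<noteq> f i v"
    by auto
  \<comment> \<open>Now \<open>x\<close> differs from \<open>u\<close> on all of
    \<open>dif v u\<close> and also in \<open>i\<close>, where \<open>u\<close> agrees with
    \<open>v\<close>; again \<open>t + 2\<close> colors.\<close>
  have "j \<in> dif u x" if j: "j \<in> dif v u" for j
  proof (cases "j = s")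
    case True
    then show ?thesis
      using neq j by (auto simp: dif_def)
  next
    case False
    then have "j \<notin> dif v x"
      using only_s[of j] j disj by blast
    then show ?thesis
      using j by (auto simp: dif_def)
  qed
  moreover have "i \<in> dif u x" "i \<notin> dif v u"
    using i disj by (auto simp: dif_def)
  ultimately have "card (insert i (dif v u)) \<le> card (dif u x)"
    by (intro card_mono) auto
  then show False
    using card_dif_le[of a c u x] abc mem tight \<open>i \<notin> dif v u\<close> by auto
qed

lemma no_two_tight:
  assumes ab: "a \<in> {1..r}" "b \<in> {1..r}" "a \<noteq> b" and mem: "u \<in> P a" "v \<in> P b"
    and c: "c \<in> {1..r}" "y \<in> P c" "c \<noteq> b"
    and tight: "card (dif v u) = t + 1" "card (dif v y) = t + 1"
    and disj: "dif v u \<inter> dif v y = {}"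
  shows False
proof (cases "c = a")
  case False
  \<comment> \<open>With three distinct classes this set has at most one element, but its size is
    \<open>t + 1 \<ge> 2\<close>.\<close>
  have "dif v y - dif v u = dif v y"
    using disj by auto
  then show False
    using card_dif_third[of b a c v u y] False assms t by auto
next
  case True
  have "\<not> {1..r} \<subseteq> {a, b}"
    using card_mono[of "{a, b}" "{1..r}"] t card_insert_le_m1[of 2 "{b}" a] by auto
  then obtain d where d: "d \<in> {1..r}" "d \<noteq> a" "d \<noteq> b"
    by blast
  obtain s where s: "s \<in> dif v u"
    using tight(1) by fastforce
  then have sI: "s \<in> I"
    by (simp add: dif_def)
  have uv: "u \<in> partite_verts r P" "v \<in> partite_verts r P"
    using ab mem partite_vertsI by blast+
  \<comment> \<open>Two components are allowed here because \<open>t \<ge> 1\<close>. The component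
    of \<open>z\<close> then reaches the third class \<open>d\<close>, where
    \<open>third_class_agrees\<close> forbids such a vertex.\<close>
  obtain z where z: "z \<in> partite_verts r P" "f s z \<noteq> f s u" "f s z \<noteq> f s v"
    using no_cover[of "{(s, u), (s, v)}"] uv sI t card_insert_le_m1[of 2 "{(s, v)}" "(s, u)"]
    by auto
  obtain x where "x \<in> P d" "f s x = f s z"
    using meets[OF sI z(1) d(1)] by auto
  then show False
    using third_class_agrees[of a b d u y v x s] True assms d s z by auto
qed

text \<open>The bound \<open>t + 2 \<le> r\<close> enters in full: at least
  \<open>r - 1 \<ge> t + 1\<close> colors remain outside \<open>D\<close>.\<close>

lemma exists_disjoint_color_set:
  assumes "D \<subseteq> I" "card D \<le> t + 1"
  obtains S where "S \<subseteq> I - D" "card S = t + 1"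
proof -
  have "t + 1 \<le> card (I - D)"
    using assms card_I t by (simp add: card_Diff_subset finite_subset)
  then show ?thesis
    using obtain_subset_with_card_n that by metis
qed

lemma inconsistent: False
proof -
  have dif_I: "dif u v \<subseteq> I" for u v
    by (auto simp: dif_def)
  \<comment> \<open>One pair at distance \<open>t + 1\<close> yields a second, sharing a vertex with
    it and using disjoint colors, which \<open>no_two_tight\<close> excludes.\<close>
  have tightE: False if ab: "a \<in> {1..r}" "b \<in> {1..r}" "a \<noteq> b" "u \<in> P a" "v \<in> P b"
    and uv: "card (dif u v) = t + 1" for a b u v
  proof -
    obtain T where T: "T \<subseteq> I - dif u v" "card T = t + 1"
      using exists_disjoint_color_set[OF dif_I] uv by (metis order_refl)
    obtain c y where c: "c \<in> {1..r}" "y \<in> P c"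
      and "c \<noteq> a \<and> dif u y = T \<or> c \<noteq> b \<and> dif v y = T"
      using tight_vertex[OF ab T] .
    then show False
      using no_two_tight[of a b u v c y] no_two_tight[of b a v u c y] ab uv T
        dif_commute[of u v] by auto
  qed
  have ix: "1 \<in> {1..r}" "2 \<in> {1..r}"
    using t by auto
  then obtain u v where uv: "u \<in> P 1" "v \<in> P 2"
    using nonempty by blast
  \<comment> \<open>Any pair from two classes now suffices to produce a pair at distance exactly
    \<open>t + 1\<close>.\<close>
  obtain S where S: "S \<subseteq> I - dif u v" "card S = t + 1"
    using exists_disjoint_color_set[OF dif_I] card_dif_le[OF ix _ uv] by auto
  obtain c y where "c \<in> {1..r}" "y \<in> P c" "c \<noteq> 1 \<and> dif u y = S \<or> c \<noteq> 2 \<and> dif v y = S"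
    using tight_vertex[OF ix _ uv S] by auto
  then show False
    using tightE[of 1 c u y] tightE[of 2 c v y] ix uv S by auto
qed

end

section \<open>Components as classes of an equivalence relation\<close>

lemma joined_refl: "joined E u u"
  by (simp add: joined_def)

lemma joined_edge: "e \<in> E \<Longrightarrow> u \<in> e \<Longrightarrow> v \<in> e \<Longrightarrow> joined E u v"
  unfolding joined_def by (intro disjI2 exI[of _ "[e]"]) auto

lemma joined_sym:
  assumes "joined E u v"
  shows "joined E v u"
proof (cases "u = v")
  case False
  then obtain es where "es \<noteq> []" "set es \<subseteq> E" "u \<in> hd es" "v \<in> last es"
      "successively (\<lambda>e f. e \<inter> f \<noteq> {}) es"
    using assms by (auto simp: joined_def)
  then show ?thesis
    unfolding joined_def
    by (intro disjI2 exI[of _ "rev es"]) (auto simp: hd_rev last_rev Int_commute)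
qed (simp add: joined_refl)

lemma joined_trans:
  assumes "joined E u v" "joined E v w"
  shows "joined E u w"
proof (cases "u = v \<or> v = w")
  case False
  then obtain es fs where "es \<noteq> []" "set es \<subseteq> E" "u \<in> hd es" "v \<in> last es"
      "successively (\<lambda>e f. e \<inter> f \<noteq> {}) es"
      "fs \<noteq> []" "set fs \<subseteq> E" "v \<in> hd fs" "w \<in> last fs"
      "successively (\<lambda>e f. e \<inter> f \<noteq> {}) fs"
    using assms by (auto simp: joined_def)
  then show ?thesis
    unfolding joined_def
    by (intro disjI2 exI[of _ "es @ fs"]) (auto simp: successively_append_iff)
qed (use assms in auto)

lemma component_eq_iff:
  assumes "v \<in> V"
  shows "{x \<in> V. joined E u x} = {x \<in> V. joined E v x} \<longleftrightarrow> joined E u v"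
  using assms joined_refl joined_sym joined_trans by (smt (verit) Collect_cong mem_Collect_eq)

section \<open>Reduction of spanning colorings to the abstract setting\<close>

lemma transversal_edge:
  assumes "partite_classes r P" and p: "\<And>j. j \<in> {1..r} \<Longrightarrow> p j \<in> P j"
  shows "p ` {1..r} \<in> complete_partite_edges r P"
proof -
  have "p ` {1..r} \<inter> P j = {p j}" if j: "j \<in> {1..r}" for j
  proof -
    have "i = j" if "i \<in> {1..r}" "p i \<in> P j" for i
      using assms(1) p[OF that(1)] that j unfolding partite_classes_def by blast
    then show ?thesis
      using p[OF j] j by blast
  qed
  then show ?thesis
    using p by (auto simp: complete_partite_edges_def partite_verts_def)
qed

lemma cover_number_le:
  assumes t: "1 \<le> t" "t + 2 \<le> r" and P: "partite_classes r P"
    and col: "coloring (r + t) (complete_partite_edges r P) col"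
    and span: "spanning (partite_verts r P) (complete_partite_edges r P) col"
  shows "cover_number (r + t) (partite_verts r P) (complete_partite_edges r P) col \<le> enat (t + 1)"
proof (rule ccontr)
  assume large: "\<not> ?thesis"
  let ?V = "partite_verts r P" and ?E = "complete_partite_edges r P"
  have "\<forall>j\<in>{1..r}. \<exists>v. v \<in> P j"
    using P by (auto simp: partite_classes_def)
  then obtain p where "\<And>j. j \<in> {1..r} \<Longrightarrow> p j \<in> P j"
    by metis
  \<comment> \<open>A transversal is an edge, so at least one color is used.\<close>
  then obtain i0 where i0: "i0 \<in> col ` ?E"
    using transversal_edge[OF P] by blast
  \<comment> \<open>Unused colors would have singleton components, violating the spanning property, so they
    are made to duplicate a used one.\<close>
  define h where "h i = (if i \<in> col ` ?E then i else i0)" for i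
  have h: "h i \<in> col ` ?E" for i
    using i0 by (simp add: h_def)
  have used: "col ` ?E \<subseteq> {1..r + t}"
    using col by (auto simp: coloring_def)
  define f where "f i v = {x \<in> ?V. joined (color_class ?E col (h i)) v x}" for i v
  have f_eq: "f i u = f i v \<longleftrightarrow> joined (color_class ?E col (h i)) u v" if "v \<in> ?V" for i u v
    unfolding f_def using component_eq_iff[OF that] .
  interpret uncoverable_coloring r t P "{1..r + t}" f
  proof
    show "P j \<noteq> {}" if "j \<in> {1..r}" for j
      using P that by (auto simp: partite_classes_def)
  next
    fix p
    assume p: "\<And>j. j \<in> {1..r} \<Longrightarrow> p j \<in> P j"
    let ?e = "p ` {1..r}"
    have e: "?e \<in> ?E"
      using transversal_edge[OF P p] .
    \<comment> \<open>The color of an edge is used, hence fixed by \<open>h\<close>, so the whole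
      edge lies in one component of that color.\<close>
    then have "h (col ?e) = col ?e"
      by (simp add: h_def)
    then have "?e \<in> color_class ?E col (h (col ?e))"
      using e by (simp add: color_class_def)
    moreover have "p j \<in> ?V" if "j \<in> {1..r}" for j
      using p[OF that] that by (auto simp: partite_verts_def)
    ultimately have "\<forall>j\<in>{1..r}. \<forall>j'\<in>{1..r}. f (col ?e) (p j) = f (col ?e) (p j')"
      using f_eq joined_edge by (metis imageI)
    then show "\<exists>i\<in>{1..r + t}. \<forall>j\<in>{1..r}. \<forall>j'\<in>{1..r}. f i (p j) = f i (p j')"
      using e used by blast
  next
    fix i v j
    assume v: "v \<in> ?V" and j: "j \<in> {1..r}"
    obtain e where e: "e \<in> color_class ?E col (h i)" "v \<in> e"
      using span h v by (meson spanning_def)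
    then have "card (e \<inter> P j) = 1"
      using j by (auto simp: color_class_def complete_partite_edges_def)
    then obtain w where "w \<in> e" "w \<in> P j"
      by (metis Int_iff card_1_singletonE insertI1)
    then show "\<exists>w\<in>P j. f i w = f i v"
      using f_eq[OF v] e joined_edge by metis
  next
    fix K
    assume K: "finite K" "K \<subseteq> {1..r + t} \<times> ?V" "card K \<le> t + 1"
    \<comment> \<open>Different pairs may name the same component, which only lowers the count;
      through \<open>h\<close>, each set named is a genuine monochromatic component.\<close>
    let ?C = "(\<lambda>(i, v). f i v) ` K"
    have "?C \<subseteq> mono_components (r + t) ?V ?E col"
    proof clarify
      fix i v
      assume "(i, v) \<in> K"
      then have "f i v \<in> components ?V (color_class ?E col (h i))"
        using K by (auto simp: f_def components_def)
      then show "f i v \<in> mono_components (r + t) ?V ?E col"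
        using h used by (auto simp: mono_components_def)
    qed
    moreover have "\<not> ?V \<subseteq> \<Union>?C"
    proof
      assume "?V \<subseteq> \<Union>?C"
      then have "cover_number (r + t) ?V ?E col \<le> enat (card ?C)"
        using calculation K(1) unfolding cover_number_def by (intro Inf_lower) blast
      also have "\<dots> \<le> enat (t + 1)"
        using card_image_le[OF K(1)] K(3) by (meson enat_ord_simps(1) order_trans)
      finally show False
        using large by blast
    qed
    ultimately obtain w where w: "w \<in> ?V" "w \<notin> \<Union>?C"
      by blast
    have "f i w \<noteq> f i v" if iv: "(i, v) \<in> K" for i v
    proof
      assume "f i w = f i v"
      moreover have "w \<in> f i w"
        using w by (simp add: f_def joined_refl)
      ultimately show False
        using w(2) iv by force
    qed
    then show "\<exists>w\<in>?V. \<forall>(i, v)\<in>K. f i w \<noteq> f i v"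
      using w(1) by blast
  qed (use t in auto)
  show False
    by (rule inconsistent)
qed

theorem theorem2p5:
  fixes r t :: nat
  assumes "r \<ge> 3" and "1 \<le> t" and "t \<le> r - 2"
  shows "cov TYPE('v) r (r + t) \<le> enat (t + 1)"
proof -
  have "t + 2 \<le> r"
    using assms by simp
  then show ?thesis
    unfolding cov_def using cover_number_le assms(2) by (intro Sup_least) blast
qed

end
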